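(* Let $H$ be any polarised Hamiltonian with $k$ arguments of the Hamiltonian $\mathcal{H}$, let $\frac{\delta H}{\delta(w_1,\dots,w_{k+1})}$ be a discrete variational derivative of $H$, and let $D$ be a skew-symmetric operator approximating $\mathcal{D}$. Let $(U^n)_{n\ge 0}$ be a sequence produced, from given starting values $U^0,\dots,U^{k-1}$, by the polarised discrete variational derivative (PDVD) scheme $$\frac{U^{n+k}-U^{n}}{k\,\Delta t}=k\,D\,\frac{\delta H}{\delta(U^{n},\dots,U^{n+k})},\qquad n\ge 0 .$$ Then the scheme is conservative in the sense that $$H[U^{n+1},\dots,U^{n+k}]=H[U^{0},\dots,U^{k-1}]\qquad\text{for all } n\ge 1 .$$
   Context: Setting. Consider PDEs $u_t=\mathcal{D}\frac{\delta\mathcal{H}}{\delta u}$ for $u=(u^1,\dots,u^m)$ with values in $\mathbb{R}^m$, a function of time and of $x\in\Omega\subseteq\mathbb{R}^d$. Here $\mathcal{H}[u]=\int_\Omega \mathcal{G}[u]\,\mathrm{d}x$, where square brackets mean that $\mathcal{G}$ depends on $u$ and on finitely many of its partial derivatives with respect to $x$. The variational derivative is defined by $\int_\Omega\frac{\delta\mathcal{H}}{\delta u}\cdot\varphi\,\mathrm{d}x=\frac{\partial}{\partial\epsilon}\big|_{\epsilon=0}\mathcal{H}[u+\epsilon\varphi]$ for all sufficiently smooth $\varphi$. The operator $\mathcal{D}$ may depend on $u$ and is skew-symmetric for the $L^2$ inner product, i.e. $\int_\Omega(\mathcal{D}v)\cdot w\,\mathrm{d}x=-\int_\Omega v\cdot(\mathcal{D}w)\,\mathrm{d}x$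 for all $v,w$. Throughout, all functions are assumed sufficiently regular and the boundary conditions (e.g. periodic) are such that boundary terms vanish in integration by parts. Polarised Hamiltonian. A polarised Hamiltonian of $\mathcal{H}$ with $k$ arguments is a functional $H[w_1,\dots,w_k]$ that is consistent, $H[u,u,\dots,u]=\mathcal{H}[u]$, and invariant under cyclic permutations of its arguments, $H[w_1,w_2,\dots,w_k]=H[w_2,\dots,w_k,w_1]$. Discrete variational derivative of $H$. This is a continuous function $\frac{\delta H}{\delta(w_1,\dots,w_{k+1})}$ of $k+1$ arguments (functions of $x$, possibly entering together with their derivatives) satisfying $$H[w_2,\dots,w_{k+1}]-H[w_1,\dots,w_k]=\int_\Omega\frac{\delta H}{\delta(w_1,\dots,w_{k+1})}\cdot(w_{k+1}-w_1)\,\mathrm{d}x,\qquad k\,\frac{\delta H}{\delta(u,\dots,u)}=\frac{\delta\mathcal{H}}{\delta u}.$$ Scheme. $\Delta t>0$ is the time step and $U^n=U^n(x)$ approximates the solution at time $n\Delta t$ (space is kept continuous). In the scheme, $D$ is skew-symmetric for the $L^2$ inner product, may depend on $U^{n+1},\dots,U^{n+k-1}$ (but not on $U^{n+k}$), and is consistent: $D[u,\dots,u]=\mathcal{D}[u]$. *)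

theory Defs
  imports "HOL-Analysis.Analysis"
begin

type_synonym ('d, 'm) vfield = "real ^ 'd \<Rightarrow> real ^ 'm"

text \<open>
  Functions of \<open>x \<in> \<Omega>\<close> are total functions on the whole Euclidean space. Derivatives are
  taken at points of \<open>\<Omega>\<close>, integrals over \<open>\<Omega>\<close>, and equalities of functions are asserted on
  \<open>\<Omega>\<close> only.
\<close>

definition partial_deriv :: "'d::finite \<Rightarrow> ('d, 'm::finite) vfield \<Rightarrow> ('d, 'm) vfield" where
  "partial_deriv i u x = vector_derivative (\<lambda>t. u (x + t *\<^sub>R axis i 1)) (at 0)"

definition iter_partial :: "'d::finite list \<Rightarrow> ('d, 'm::finite) vfield \<Rightarrow> ('d, 'm) vfield" where
  "iter_partial \<alpha> u = foldr partial_deriv \<alpha> u"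

definition C_diff_on :: "nat \<Rightarrow> (real ^ 'd) set \<Rightarrow> ('d::finite, 'm::finite) vfield \<Rightarrow> bool" where
  "C_diff_on r S u \<longleftrightarrow>
     (\<forall>\<alpha> i. length \<alpha> < r \<longrightarrow>
        (\<forall>x\<in>S. (\<lambda>t. iter_partial \<alpha> u (x + t *\<^sub>R axis i 1)) differentiable (at 0))) \<and>
     (\<forall>\<alpha>. length \<alpha> \<le> r \<longrightarrow> continuous_on S (iter_partial \<alpha> u))"

text \<open>For a set \<open>\<Omega>\<close> that need not be open, \<open>C\<^sup>r\<close> on \<open>\<Omega>\<close> means \<open>C\<^sup>r\<close> on some open
  neighbourhood of \<open>\<Omega>\<close>.\<close>

definition regular :: "nat \<Rightarrow> (real ^ 'd) set \<Rightarrow> ('d::finite, 'm::finite) vfield \<Rightarrow> bool" where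
  "regular r \<Omega> u \<longleftrightarrow> (\<exists>S. open S \<and> \<Omega> \<subseteq> S \<and> C_diff_on r S u)"

definition test_function :: "(real ^ 'd) set \<Rightarrow> ('d::finite, 'm::finite) vfield \<Rightarrow> bool" where
  "test_function \<Omega> \<phi> \<longleftrightarrow>
     (\<forall>r. C_diff_on r UNIV \<phi>) \<and>
     (\<exists>K. compact K \<and> K \<subseteq> interior \<Omega> \<and> (\<forall>x. x \<notin> K \<longrightarrow> \<phi> x = 0))"

definition linear_space :: "('d::finite, 'm::finite) vfield set \<Rightarrow> bool" where
  "linear_space X \<longleftrightarrow>
     (\<lambda>x. 0) \<in> X \<and>
     (\<forall>u\<in>X. \<forall>v\<in>X. (\<lambda>x. u x + v x) \<in> X) \<and>
     (\<forall>c. \<forall>u\<in>X. (\<lambda>x. c *\<^sub>R u x) \<in> X)"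

text \<open>
  The standing convention ``sufficiently regular functions, with suitable boundary conditions'':
  \<open>V\<close> is the set of states (smoothness and boundary conditions imposed), \<open>T\<close> the space of
  variations of states, and \<open>W \<supseteq> T\<close> the space on which the skew-symmetric operators act and in which
  the (discrete) variational derivatives lie. For periodic boundary conditions all three may be the
  space of smooth periodic functions. The number \<open>r\<close> bounds the order of the derivatives that
  enter. \<open>T\<close> contains all test functions up to their values off \<open>\<Omega>\<close> (periodic extension!), which
  makes variational derivatives unique almost everywhere on the interior of \<open>\<Omega>\<close>.
\<close>

definition admissible_spaces ::
  "nat \<Rightarrow> (real ^ 'd) set \<Rightarrow> ('d::finite, 'm::finite) vfield set \<Rightarrow> ('d, 'm) vfield set \<Rightarrow>
   ('d, 'm) vfield set \<Rightarrow> bool" where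
  "admissible_spaces r \<Omega> V T W \<longleftrightarrow>
     \<Omega> \<in> sets lebesgue \<and>
     (\<forall>u\<in>V. regular r \<Omega> u) \<and>
     (\<forall>\<phi>\<in>T. regular r \<Omega> \<phi>) \<and>
     linear_space T \<and> linear_space W \<and> T \<subseteq> W \<and>
     (\<forall>\<phi>. test_function \<Omega> \<phi> \<longrightarrow> (\<exists>\<psi>\<in>T. \<forall>x\<in>\<Omega>. \<psi> x = \<phi> x)) \<and>
     (\<forall>u\<in>V. \<forall>\<phi>\<in>T. \<forall>\<^sub>F \<epsilon> in at 0. (\<lambda>x. u x + \<epsilon> *\<^sub>R \<phi> x) \<in> V)"

definition has_L2_product ::
  "(real ^ 'd) set \<Rightarrow> ('d::finite, 'm::finite) vfield \<Rightarrow> ('d, 'm) vfield \<Rightarrow> bool" where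
  "has_L2_product \<Omega> v w \<longleftrightarrow> set_integrable lebesgue \<Omega> (\<lambda>x. v x \<bullet> w x)"

definition L2_product ::
  "(real ^ 'd) set \<Rightarrow> ('d::finite, 'm::finite) vfield \<Rightarrow> ('d, 'm) vfield \<Rightarrow> real" where
  "L2_product \<Omega> v w = (LINT x:\<Omega>|lebesgue. v x \<bullet> w x)"

definition skew_symmetric_op ::
  "(real ^ 'd) set \<Rightarrow> ('d::finite, 'm::finite) vfield set \<Rightarrow>
   (('d, 'm) vfield \<Rightarrow> ('d, 'm) vfield) \<Rightarrow> bool" where
  "skew_symmetric_op \<Omega> W D \<longleftrightarrow>
     (\<forall>v\<in>W. \<forall>w\<in>W. has_L2_product \<Omega> (D v) w \<and> has_L2_product \<Omega> v (D w) \<and>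
        L2_product \<Omega> (D v) w = - L2_product \<Omega> v (D w))"

text \<open>
  A density \<open>G\<close> of order \<open>r\<close> is a function of the values of all partial derivatives up to order
  \<open>r\<close>; the entries of the jet beyond order \<open>r\<close> carry no information.
\<close>

definition jet :: "nat \<Rightarrow> ('d::finite, 'm::finite) vfield \<Rightarrow> real ^ 'd \<Rightarrow> 'd list \<Rightarrow> real ^ 'm" where
  "jet r u x = (\<lambda>\<alpha>. if length \<alpha> \<le> r then iter_partial \<alpha> u x else 0)"

definition Hamiltonian ::
  "nat \<Rightarrow> (real ^ 'd) set \<Rightarrow> (('d::finite list \<Rightarrow> real ^ 'm::finite) \<Rightarrow> real) \<Rightarrow>
   ('d, 'm) vfield \<Rightarrow> real" where
  "Hamiltonian r \<Omega> G u = (LINT x:\<Omega>|lebesgue. G (jet r u x))"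

definition Hamiltonian_defined_on ::
  "nat \<Rightarrow> (real ^ 'd) set \<Rightarrow> (('d::finite list \<Rightarrow> real ^ 'm::finite) \<Rightarrow> real) \<Rightarrow>
   ('d, 'm) vfield set \<Rightarrow> bool" where
  "Hamiltonian_defined_on r \<Omega> G V \<longleftrightarrow>
     (\<forall>u\<in>V. set_integrable lebesgue \<Omega> (\<lambda>x. G (jet r u x)))"

definition variational_derivative ::
  "(real ^ 'd) set \<Rightarrow> ('d::finite, 'm::finite) vfield set \<Rightarrow> ('d, 'm) vfield set \<Rightarrow>
   ('d, 'm) vfield set \<Rightarrow> (('d, 'm) vfield \<Rightarrow> real) \<Rightarrow> (('d, 'm) vfield \<Rightarrow> ('d, 'm) vfield) \<Rightarrow> bool"
  where
  "variational_derivative \<Omega> V T W Ham dHam \<longleftrightarrow>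
     (\<forall>u\<in>V. dHam u \<in> W \<and>
        (\<forall>\<phi>\<in>T. has_L2_product \<Omega> (dHam u) \<phi> \<and>
           ((\<lambda>\<epsilon>. Ham (\<lambda>x. u x + \<epsilon> *\<^sub>R \<phi> x)) has_real_derivative L2_product \<Omega> (dHam u) \<phi>) (at 0)))"

text \<open>Functionals of \<open>k\<close> arguments are functions of lists, constrained on lists of length \<open>k\<close>.\<close>

definition args :: "nat \<Rightarrow> 'a set \<Rightarrow> 'a list set" where
  "args k V = {ws. length ws = k \<and> set ws \<subseteq> V}"

definition polarised_Hamiltonian ::
  "('d::finite, 'm::finite) vfield set \<Rightarrow> nat \<Rightarrow> (('d, 'm) vfield \<Rightarrow> real) \<Rightarrow>
   (('d, 'm) vfield list \<Rightarrow> real) \<Rightarrow> bool" where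
  "polarised_Hamiltonian V k Ham H \<longleftrightarrow>
     (\<forall>u\<in>V. H (replicate k u) = Ham u) \<and>
     (\<forall>ws\<in>args k V. H ws = H (rotate1 ws))"

text \<open>
  Continuity in arguments that may enter together with their derivatives: continuity with respect
  to uniform convergence on \<open>\<Omega>\<close> of the arguments and their derivatives up to order \<open>r\<close>. Any
  continuous function of the pointwise values of these derivatives has this property.
\<close>

definition continuous_in_args ::
  "nat \<Rightarrow> (real ^ 'd) set \<Rightarrow> ('d::finite, 'm::finite) vfield set \<Rightarrow> nat \<Rightarrow>
   (('d, 'm) vfield list \<Rightarrow> ('d, 'm) vfield) \<Rightarrow> bool" where
  "continuous_in_args r \<Omega> V j F \<longleftrightarrow>
     (\<forall>ws\<in>args j V. \<forall>x\<in>\<Omega>. \<forall>\<epsilon>>0. \<exists>\<delta>>0. \<forall>vs\<in>args j V.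
        (\<forall>i<j. \<forall>\<alpha>. length \<alpha> \<le> r \<longrightarrow>
           (\<forall>y\<in>\<Omega>. dist (iter_partial \<alpha> (vs ! i) y) (iter_partial \<alpha> (ws ! i) y) < \<delta>)) \<longrightarrow>
        dist (F vs x) (F ws x) < \<epsilon>)"

text \<open>For \<open>ws = [w\<^sub>1, \<dots>, w\<^sub>k\<^sub>+\<^sub>1]\<close>, the lists \<open>tl ws\<close> and \<open>butlast ws\<close> are \<open>[w\<^sub>2, \<dots>, w\<^sub>k\<^sub>+\<^sub>1]\<close> and
  \<open>[w\<^sub>1, \<dots>, w\<^sub>k]\<close>.\<close>

definition discrete_variational_derivative ::
  "nat \<Rightarrow> (real ^ 'd) set \<Rightarrow> ('d::finite, 'm::finite) vfield set \<Rightarrow> ('d, 'm) vfield set \<Rightarrow> nat \<Rightarrow>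
   (('d, 'm) vfield list \<Rightarrow> real) \<Rightarrow> (('d, 'm) vfield \<Rightarrow> ('d, 'm) vfield) \<Rightarrow>
   (('d, 'm) vfield list \<Rightarrow> ('d, 'm) vfield) \<Rightarrow> bool" where
  "discrete_variational_derivative r \<Omega> V W k H dHam dH \<longleftrightarrow>
     continuous_in_args r \<Omega> V (k + 1) dH \<and>
     (\<forall>ws\<in>args (k + 1) V.
        dH ws \<in> W \<and>
        has_L2_product \<Omega> (dH ws) (\<lambda>x. last ws x - hd ws x) \<and>
        H (tl ws) - H (butlast ws) = L2_product \<Omega> (dH ws) (\<lambda>x. last ws x - hd ws x)) \<and>
     (\<forall>u\<in>V. \<forall>x\<in>\<Omega>. real k *\<^sub>R dH (replicate (k + 1) u) x = dHam u x)"

text \<open>The argument list of \<open>D\<close> is \<open>[U\<^sup>n\<^sup>+\<^sup>1, \<dots>, U\<^sup>n\<^sup>+\<^sup>k\<^sup>-\<^sup>1]\<close>, of length \<open>k - 1\<close>.\<close>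

definition consistent_skew_approximation ::
  "(real ^ 'd) set \<Rightarrow> ('d::finite, 'm::finite) vfield set \<Rightarrow> ('d, 'm) vfield set \<Rightarrow> nat \<Rightarrow>
   (('d, 'm) vfield \<Rightarrow> ('d, 'm) vfield \<Rightarrow> ('d, 'm) vfield) \<Rightarrow>
   (('d, 'm) vfield list \<Rightarrow> ('d, 'm) vfield \<Rightarrow> ('d, 'm) vfield) \<Rightarrow> bool" where
  "consistent_skew_approximation \<Omega> V W k Dop D \<longleftrightarrow>
     (\<forall>ws\<in>args (k - 1) V. skew_symmetric_op \<Omega> W (D ws)) \<and>
     (\<forall>u\<in>V. \<forall>v\<in>W. \<forall>x\<in>\<Omega>. D (replicate (k - 1) u) v x = Dop u v x)"

definition PDVD_scheme ::
  "(real ^ 'd) set \<Rightarrow> nat \<Rightarrow> real \<Rightarrow>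
   (('d::finite, 'm::finite) vfield list \<Rightarrow> ('d, 'm) vfield \<Rightarrow> ('d, 'm) vfield) \<Rightarrow>
   (('d, 'm) vfield list \<Rightarrow> ('d, 'm) vfield) \<Rightarrow> (nat \<Rightarrow> ('d, 'm) vfield) \<Rightarrow> bool" where
  "PDVD_scheme \<Omega> k \<Delta>t D dH U \<longleftrightarrow>
     (\<forall>n. \<forall>x\<in>\<Omega>.
        (U (n + k) x - U n x) /\<^sub>R (real k * \<Delta>t) =
        real k *\<^sub>R D (map U [n + 1..<n + k]) (dH (map U [n..<n + k + 1])) x)"

end

theory Submission
  imports Defs
begin

text \<open>Shifting the window of \<open>k\<close> consecutive iterates by one step drops
  \<open>U n\<close> and gains \<open>U (n + k)\<close>. The defining identity of the discrete
  variational derivative turns the resulting change of \<open>H\<close> into the L2 product of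
  \<open>dH\<close> with \<open>U (n + k) - U n\<close>. By the scheme this difference is a constant
  multiple of \<open>D\<close> applied to that same \<open>dH\<close>, and a skew-symmetric operator
  satisfies \<open>L2_product \<Omega> v (D v) = 0\<close> (\<open>skew_symmetric_op_self\<close>).
  So each step preserves \<open>H\<close> (\<open>PDVD_scheme_step\<close>), and induction leads
  back to the starting values.\<close>

lemma skew_symmetric_op_self:
  assumes "skew_symmetric_op \<Omega> W D" and "v \<in> W"
  shows "L2_product \<Omega> v (D v) = 0"
proof -
  have "L2_product \<Omega> (D v) v = - L2_product \<Omega> v (D v)"
    using assms unfolding skew_symmetric_op_def by blast
  moreover have "L2_product \<Omega> (D v) v = L2_product \<Omega> v (D v)"
    unfolding L2_product_def by (simp only: inner_commute)
  ultimately show ?thesis by simp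
qed

text \<open>The iterates on which \<open>D\<close> depends act as frozen parameters: within one step
  it is a single skew-symmetric operator, evaluated on \<open>dH\<close> and paired with
  \<open>dH\<close>.\<close>

lemma PDVD_scheme_step:
  assumes "\<Omega> \<in> sets lebesgue"
    and "k \<ge> 1"
    and dH: "discrete_variational_derivative r \<Omega> V W k H dHam dH"
    and D: "consistent_skew_approximation \<Omega> V W k Dop D"
    and "\<Delta>t \<noteq> 0"
    and U: "\<And>n. U n \<in> V"
    and scheme: "PDVD_scheme \<Omega> k \<Delta>t D dH U"
  shows "H (map U [Suc n..<Suc n + k]) = H (map U [n..<n + k])"
proof -
  define ws where "ws = map U [n..<n + k + 1]"
  define us where "us = map U [n + 1..<n + k]"
  \<comment> \<open>Solving the scheme for \<open>U (n + k) - U n\<close> gives this factor: the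
    denominator \<open>real k * \<Delta>t\<close> times the \<open>real k\<close> on the right-hand
    side.\<close>
  define c where "c = (real k * \<Delta>t) * real k"
  have ws: "ws \<in> args (k + 1) V" and us: "us \<in> args (k - 1) V"
    using U by (auto simp: ws_def us_def args_def)
  have tl: "tl ws = map U [Suc n..<Suc n + k]"
    by (simp add: ws_def map_tl flip: tl_upt)
  have butlast: "butlast ws = map U [n..<n + k]"
    by (simp add: ws_def)
  have last: "last ws = U (n + k)"
    by (simp add: ws_def)
  have hd: "hd ws = U n"
    using \<open>k \<ge> 1\<close> by (simp add: ws_def hd_append hd_map)
  \<comment> \<open>The scheme holds pointwise on \<open>\<Omega>\<close>, which suffices under an
    integral over \<open>\<Omega>\<close>.\<close>
  have diff: "last ws x - hd ws x = c *\<^sub>R D us (dH ws) x" if "x \<in> \<Omega>" for x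
  proof -
    have "real k * \<Delta>t \<noteq> 0"
      using \<open>k \<ge> 1\<close> \<open>\<Delta>t \<noteq> 0\<close> by simp
    then have "last ws x - hd ws x = (real k * \<Delta>t) *\<^sub>R ((U (n + k) x - U n x) /\<^sub>R (real k * \<Delta>t))"
      \<comment> \<open>The product \<open>real k * \<Delta>t\<close> must stay unsplit for
        \<open>right_inverse\<close> to cancel it.\<close>
      by (simp add: last hd right_inverse del: inverse_mult_distrib mult_eq_0_iff)
    also have "(U (n + k) x - U n x) /\<^sub>R (real k * \<Delta>t) = real k *\<^sub>R D us (dH ws) x"
      using scheme that unfolding PDVD_scheme_def ws_def us_def by blast
    finally show ?thesis
      by (simp only: c_def scaleR_scaleR)
  qed
  have "H (tl ws) - H (butlast ws) = L2_product \<Omega> (dH ws) (\<lambda>x. last ws x - hd ws x)"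
    using dH ws unfolding discrete_variational_derivative_def by blast
  also have "\<dots> = (LINT x:\<Omega>|lebesgue. c * (dH ws x \<bullet> D us (dH ws) x))"
    unfolding L2_product_def
    by (rule set_lebesgue_integral_cong) (simp_all add: diff \<open>\<Omega> \<in> sets lebesgue\<close>)
  also have "\<dots> = c * L2_product \<Omega> (dH ws) (D us (dH ws))"
    by (simp add: L2_product_def)
  also have "L2_product \<Omega> (dH ws) (D us (dH ws)) = 0"
  proof (rule skew_symmetric_op_self)
    show "skew_symmetric_op \<Omega> W (D us)"
      using D us unfolding consistent_skew_approximation_def by blast
    show "dH ws \<in> W"
      using dH ws unfolding discrete_variational_derivative_def by blast
  qed
  finally show ?thesis
    by (simp add: tl butlast)
qed

theorem theorem4p3:
  fixes \<Omega> :: "(real ^ 'd::finite) set"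
    and V T W :: "('d, 'm::finite) vfield set"
    and r k :: nat
    and G :: "('d list \<Rightarrow> real ^ 'm) \<Rightarrow> real"
    and Dop :: "('d, 'm) vfield \<Rightarrow> ('d, 'm) vfield \<Rightarrow> ('d, 'm) vfield"
    and dHam :: "('d, 'm) vfield \<Rightarrow> ('d, 'm) vfield"
    and H :: "('d, 'm) vfield list \<Rightarrow> real"
    and dH :: "('d, 'm) vfield list \<Rightarrow> ('d, 'm) vfield"
    and D :: "('d, 'm) vfield list \<Rightarrow> ('d, 'm) vfield \<Rightarrow> ('d, 'm) vfield"
    and \<Delta>t :: real
    and U :: "nat \<Rightarrow> ('d, 'm) vfield"
  assumes "admissible_spaces r \<Omega> V T W"
    and "Hamiltonian_defined_on r \<Omega> G V"
    and "variational_derivative \<Omega> V T W (Hamiltonian r \<Omega> G) dHam"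
    and "\<forall>u\<in>V. skew_symmetric_op \<Omega> W (Dop u)"
    and "k \<ge> 1"
    and "polarised_Hamiltonian V k (Hamiltonian r \<Omega> G) H"
    and "discrete_variational_derivative r \<Omega> V W k H dHam dH"
    and "consistent_skew_approximation \<Omega> V W k Dop D"
    and "\<Delta>t > 0"
    and "\<forall>n. U n \<in> V"
    and "PDVD_scheme \<Omega> k \<Delta>t D dH U"
  shows "\<forall>n\<ge>1. H (map U [n + 1..<n + k + 1]) = H (map U [0..<k])"
proof (intro allI impI)
  fix n :: nat
  have step: "H (map U [Suc n..<Suc n + k]) = H (map U [n..<n + k])" for n
    using assms by (intro PDVD_scheme_step) (auto simp: admissible_spaces_def)
  have "H (map U [n..<n + k]) = H (map U [0..<k])" for n
  proof (induction n)
    case 0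
    show ?case by simp
  next
    case (Suc n)
    with step show ?case by metis
  qed
  \<comment> \<open>The window in the claim is the one of length \<open>k\<close> starting at
    \<open>n + 1\<close>.\<close>
  from this[of "n + 1"] show "H (map U [n + 1..<n + k + 1]) = H (map U [0..<k])"
    by (simp del: upt_Suc)
qed

end
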